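(* Let $G$ be an $n$-vertex $d$-regular multigraph with $\lambda_2(G)<\rho(d,n)$, where $\rho(d,n)$ is the second-largest eigenvalue of the matrix $$Q=\begin{pmatrix} \frac{d+1}{2} & \frac{d-1}{2} & 0 & 0 \\ d-1 & 0 & 1 & 0 \\ 0 & 1 & 0 & d-1 \\ 0 & 0 & \frac{d-1}{n-4} & d-\frac{d-1}{n-4} \end{pmatrix}.$$ Then $\kappa'(G)\ge 2$.
   Context: A multigraph is a graph in which multiple edges are allowed but loops are not. The degree of a vertex is the number of edges incident to it (counted with multiplicity), and $G$ is $d$-regular if every vertex has degree $d$. The adjacency matrix $A(G)$ has $(i,j)$ entry equal to the number of edges between vertices $v_i$ and $v_j$; its eigenvalues, listed with multiplicity, are $\lambda_1(G)\ge\lambda_2(G)\ge\cdots\ge\lambda_n(G)$. A multigraph is $k$-edge-connected if deleting any set of fewer than $k$ edges (parallel edges counted as distinct) leaves a connected multigraph; the edge-connectivity $\kappa'(G)$ is the maximum $k$ such that $G$ is $k$-edge-connected (so $\kappa'(G)=0$ if $G$ is disconnected).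
   Formalization: The hypotheses n ≥ 5 and d ≥ 1 are added: for n = 4 the matrix Q is undefined, for n = 2, d = 1 the graph K_2 is a counterexample, and for d = 0, n ≥ 5 the edgeless graph has second eigenvalue 0 < ρ(0,n) but edge-connectivity 0. *)

theory Defs
  imports "Jordan_Normal_Form.Char_Poly"
begin

text \<open>
  Edges are explicit objects, so parallel edges are distinct elements of \<open>edges G\<close> with the same
  two-element set of endpoints.
\<close>

record ('v, 'e) mgraph =
  verts :: "'v set"
  edges :: "'e set"
  ends :: "'e \<Rightarrow> 'v set"

locale multigraph =
  fixes G :: "('v, 'e) mgraph"
  assumes finite_verts: "finite (verts G)"
    and finite_edges: "finite (edges G)"
    and ends_subset: "e \<in> edges G \<Longrightarrow> ends G e \<subseteq> verts G"
    and no_loops: "e \<in> edges G \<Longrightarrow> card (ends G e) = 2"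

definition vertex_degree :: "('v, 'e) mgraph \<Rightarrow> 'v \<Rightarrow> nat" where
  "vertex_degree G v = card {e \<in> edges G. v \<in> ends G e}"

definition regular :: "('v, 'e) mgraph \<Rightarrow> nat \<Rightarrow> bool" where
  "regular G d \<longleftrightarrow> (\<forall>v \<in> verts G. vertex_degree G v = d)"

definition delete_edges :: "('v, 'e) mgraph \<Rightarrow> 'e set \<Rightarrow> ('v, 'e) mgraph" where
  "delete_edges G F = G\<lparr>edges := edges G - F\<rparr>"

definition adjacency :: "('v, 'e) mgraph \<Rightarrow> ('v \<times> 'v) set" where
  "adjacency G = {(u, v). \<exists>e \<in> edges G. ends G e = {u, v}}"

definition connected_mgraph :: "('v, 'e) mgraph \<Rightarrow> bool" where
  "connected_mgraph G \<longleftrightarrow> verts G \<noteq> {} \<and> (\<forall>u \<in> verts G. \<forall>v \<in> verts G. (u, v) \<in> (adjacency G)\<^sup>*)"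

definition edge_connected :: "nat \<Rightarrow> ('v, 'e) mgraph \<Rightarrow> bool" where
  "edge_connected k G \<longleftrightarrow> (\<forall>F \<subseteq> edges G. card F < k \<longrightarrow> connected_mgraph (delete_edges G F))"

text \<open>
  Every multigraph is 0-edge-connected, and one with at least two vertices is not
  \<open>k\<close>-edge-connected for \<open>k > card (edges G)\<close>, so the maximum exists for such multigraphs.
  For a one-vertex multigraph there is no maximum and the value is unspecified.
\<close>

definition edge_connectivity :: "('v, 'e) mgraph \<Rightarrow> nat" where
  "edge_connectivity G = (GREATEST k. edge_connected k G)"

text \<open>The list \<open>vs\<close> is an enumeration \<open>v\<^sub>1, \<dots>, v\<^sub>n\<close> of the vertices.\<close>

definition adjacency_matrix :: "('v, 'e) mgraph \<Rightarrow> 'v list \<Rightarrow> real mat" where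
  "adjacency_matrix G vs = mat (length vs) (length vs)
     (\<lambda>(i, j). real (card {e \<in> edges G. ends G e = {vs ! i, vs ! j}}))"

text \<open>
  The real eigenvalues in nonincreasing order, with algebraic multiplicity. This is the complete
  spectrum for the two kinds of matrices considered: adjacency matrices are symmetric, and
  \<open>Q\<close> below is, for \<open>d \<ge> 1\<close> and \<open>n \<ge> 5\<close>, similar to a symmetric matrix via
  the diagonal matrix with entries \<open>sqrt 2, 1, 1, sqrt (n - 4)\<close>.
\<close>

definition eigenvalue_list :: "real mat \<Rightarrow> real list" where
  "eigenvalue_list A = rev (sorted_list_of_multiset (proots (char_poly A)))"

definition second_eigenvalue :: "real mat \<Rightarrow> real" where
  "second_eigenvalue A = eigenvalue_list A ! 1"

definition Q_matrix :: "nat \<Rightarrow> nat \<Rightarrow> real mat" where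
  "Q_matrix d n = mat_of_rows_list 4
    [[(real d + 1) / 2, (real d - 1) / 2,                    0,                                   0],
     [      real d - 1,                0,                    1,                                   0],
     [               0,                1,                    0,                          real d - 1],
     [               0,                0, (real d - 1) / (real n - 4), real d - (real d - 1) / (real n - 4)]]"

definition \<rho> :: "nat \<Rightarrow> nat \<Rightarrow> real" where
  "\<rho> d n = second_eigenvalue (Q_matrix d n)"

end

theory Submission
  imports Defs "HOL-Analysis.Function_Topology"
begin

text \<open>
  The theorem is proved by contraposition: if \<open>G\<close> can be disconnected by deleting at most one edge,
  a test function shows that the second eigenvalue of \<open>G\<close> is at least \<open>\<rho> d n\<close>. By the Laplacian
  identity (\<open>adjacency_form_eq_energy\<close>), a nonzero function \<open>f\<close> on the vertices with sum 0 gives the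
  lower bound \<open>d - energy(f) / \<parallel>f\<parallel>\<^sup>2\<close> for the second eigenvalue, where the energy is the sum of
  \<open>(f a - f b)\<^sup>2\<close> over all edges \<open>ab\<close> (\<open>second_eigenvalue_ge_energy\<close>).

  If some cut is empty, a function that is constant on both sides gives \<open>d\<close>, and \<open>\<rho> d n \<le> d\<close>.
  Otherwise there is a bridge \<open>xy\<close>. By parity \<open>d\<close> and the numbers of vertices of the two sides are odd,
  and the sides have at least three vertices. Functions that are constant on the four parts \<open>S - {x}\<close>,
  \<open>{x}\<close>, \<open>{y}\<close>, \<open>T - {y}\<close> have the energy of a weighted path with edge weights \<open>d - 1, 1, d - 1\<close>, and
  their norm is that of vertex masses \<open>p, 1, 1, q\<close>, where \<open>p + q = n - 2\<close> and \<open>p\<close>, \<open>q\<close> are even. The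
  matrix \<open>d - Q\<close> is the Laplacian of this path for the extreme masses \<open>2, 1, 1, n - 4\<close>, so
  \<open>t = d - \<rho> d n\<close> is its smallest positive eigenvalue. Carrying mass from the heavy end to the light
  end while keeping the eigenvector of \<open>t\<close> leaves the energy unchanged and does not decrease the
  variance, because the value at the heavy end is sufficiently small compared with the one at the light end
  (\<open>Q_eigenvector\<close>, \<open>bridge_test_values\<close>). So the eigenvector, shifted to mean 0, is a test function
  with quotient at most \<open>t\<close> for every bridge.

  The variational bound itself needs only the maximum of a quadratic form on a sphere
  (\<open>symmetric_form_max_eigenvector\<close>). The orthogonality to the constants is handled by subtracting a
  multiple of the all-ones matrix, which changes a single eigenvalue (\<open>char_poly_const_row_sum\<close>).
\<close>

section \<open>The second eigenvalue of a matrix with constant row sums\<close>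

text \<open>
  Both the adjacency matrix of a regular multigraph and the matrix \<open>Q\<close> have an obvious largest
  eigenvalue \<open>e\<close>, namely the common row sum. Splitting off one factor for it turns the second
  entry of the sorted spectrum into the largest root of the cofactor, whatever the multiplicity
  of \<open>e\<close> is.
\<close>

lemma second_eigenvalue_max_root:
  assumes cp: "char_poly A = [:- e, 1:] * p" and "p \<noteq> 0"
    and le: "\<And>x. poly p x = 0 \<Longrightarrow> x \<le> e" and "poly p r = 0"
  shows "poly p (second_eigenvalue A) = 0" "r \<le> second_eigenvalue A"
proof -
  let ?L = "sorted_list_of_multiset (proots p)"
  have set: "set ?L = {x. poly p x = 0}"
    using \<open>p \<noteq> 0\<close> by simp
  have "proots (char_poly A) = add_mset e (proots p)"
    unfolding cp using \<open>p \<noteq> 0\<close> by (subst proots_mult) auto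
  moreover have "sorted (?L @ [e])"
    using le set by (auto simp: sorted_append)
  hence "insort e ?L = ?L @ [e]"
    by (intro sorted_insort_is_snoc) (auto simp: sorted_append)
  ultimately have "second_eigenvalue A = rev ?L ! 0"
    by (simp add: second_eigenvalue_def eigenvalue_list_def)
  moreover have ne: "?L \<noteq> []"
    using set \<open>poly p r = 0\<close> by fastforce
  ultimately have eq: "second_eigenvalue A = last ?L"
    by (simp add: hd_conv_nth[symmetric] hd_rev)
  show "poly p (second_eigenvalue A) = 0"
    using last_in_set[OF ne] set unfolding eq by blast
  have "r \<in> set ?L" using set \<open>poly p r = 0\<close> by blast
  moreover have "\<forall>x \<in> set ?L. x \<le> last ?L"
  proof
    fix x assume "x \<in> set ?L"
    then obtain i where "i < length ?L" "x = ?L ! i" by (metis in_set_conv_nth)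
    thus "x \<le> last ?L"
      using sorted_sorted_list_of_multiset[of "proots p"] ne
      by (auto simp: last_conv_nth intro!: sorted_nth_mono)
  qed
  ultimately show "r \<le> second_eigenvalue A" unfolding eq by blast
qed

text \<open>
  What remains of a matrix with constant row sums when all columns are added to the first one and
  the row sum is taken out of that column.
\<close>

definition ones_col :: "'a::comm_ring_1 mat \<Rightarrow> 'a mat" where
  "ones_col M = mat (dim_row M) (dim_col M) (\<lambda>(i, j). if j = 0 then 1 else M $$ (i, j))"

text \<open>
  The sum of all columns is \<open>r\<close> times the all-ones column, so \<open>M\<close> is obtained from
  \<open>ones_col M\<close> by a lower triangular column operation with determinant \<open>r\<close>.
\<close>

lemma det_const_row_sum:
  fixes M :: "'a::idom mat"
  assumes M: "M \<in> carrier_mat n n" and "n > 0"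
    and row: "\<And>i. i < n \<Longrightarrow> (\<Sum>j<n. M $$ (i, j)) = r"
  shows "det M = r * det (ones_col M)"
proof -
  define R where "R = mat n n (\<lambda>(i, j). if j = 0 then (if i = 0 then r else - 1)
    else if i = j then 1 else 0)"
  have R: "R \<in> carrier_mat n n" by (simp add: R_def)
  have N: "ones_col M \<in> carrier_mat n n" using M by (simp add: ones_col_def)
  have "M = ones_col M * R"
  proof (rule eq_matI)
    fix i j assume "i < dim_row (ones_col M * R)" "j < dim_col (ones_col M * R)"
    hence ij: "i < n" "j < n" using N R by auto
    have "(ones_col M * R) $$ (i, j) = (\<Sum>l<n. ones_col M $$ (i, l) * R $$ (l, j))"
      using ij N R by (simp add: times_mat_def scalar_prod_def lessThan_atLeast0)
    also have "\<dots> = M $$ (i, j)"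
    proof (cases "j = 0")
      case True
      have "(\<Sum>l<n. ones_col M $$ (i, l) * R $$ (l, j))
        = (\<Sum>l<n. (if l = 0 then r + M $$ (i, 0) else 0) - M $$ (i, l))"
        using ij M True by (intro sum.cong) (auto simp: ones_col_def R_def)
      also have "\<dots> = M $$ (i, j)"
        using \<open>n > 0\<close> row[OF ij(1)] True by (simp add: sum_subtractf)
      finally show ?thesis .
    next
      case False
      have "(\<Sum>l<n. ones_col M $$ (i, l) * R $$ (l, j)) = (\<Sum>l<n. if l = j then M $$ (i, j) else 0)"
        using ij M False by (intro sum.cong) (auto simp: ones_col_def R_def)
      thus ?thesis using ij by simp
    qed
    finally show "M $$ (i, j) = (ones_col M * R) $$ (i, j)" by simp
  qed (use M N R in auto)
  hence "det M = det (ones_col M) * det R"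
    using det_mult[OF N R] by simp
  also have "det R = (\<Prod>i<n. R $$ (i, i))"
    using det_lower_triangular[OF _ R] by (simp add: R_def prod_list_diag_prod lessThan_atLeast0)
  also have "\<dots> = (\<Prod>i<n. if i = 0 then r else 1)"
    by (intro prod.cong) (auto simp: R_def)
  also have "\<dots> = r" using \<open>n > 0\<close> by simp
  finally show ?thesis by (simp add: mult.commute)
qed

text \<open>
  A constant added to all entries amounts to adding multiples of the first column, which consists
  of ones, to the others.
\<close>

lemma det_ones_col_shift:
  fixes M :: "'a::idom mat"
  assumes M: "M \<in> carrier_mat n n"
  shows "det (ones_col (mat n n (\<lambda>(i, j). M $$ (i, j) + s))) = det (ones_col M)"
proof -
  define U where "U = mat n n (\<lambda>(i, j). if i = j then 1 else if i = 0 then s else 0)"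
  let ?N = "ones_col (mat n n (\<lambda>(i, j). M $$ (i, j) + s))"
  have U: "U \<in> carrier_mat n n" by (simp add: U_def)
  have N: "ones_col M \<in> carrier_mat n n" using M by (simp add: ones_col_def)
  have "?N = ones_col M * U"
  proof (rule eq_matI)
    fix i j assume "i < dim_row (ones_col M * U)" "j < dim_col (ones_col M * U)"
    hence ij: "i < n" "j < n" using N U by auto
    have "(ones_col M * U) $$ (i, j) = (\<Sum>l<n. ones_col M $$ (i, l) * U $$ (l, j))"
      using ij N U by (simp add: times_mat_def scalar_prod_def lessThan_atLeast0)
    also have "\<dots> = (\<Sum>l<n. (if l = j then ones_col M $$ (i, j) else 0)
        + (if l = 0 then (if j = 0 then 0 else s) else 0))"
      using ij M by (intro sum.cong) (auto simp: ones_col_def U_def)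
    also have "\<dots> = ?N $$ (i, j)"
      using ij M by (simp add: sum.distrib ones_col_def)
    finally show "?N $$ (i, j) = (ones_col M * U) $$ (i, j)" by simp
  qed (use M N U in \<open>auto simp: ones_col_def\<close>)
  moreover have "det U = 1"
  proof -
    have "upper_triangular U" by (auto simp: upper_triangular_def U_def)
    hence "det U = (\<Prod>i<n. U $$ (i, i))"
      using det_upper_triangular[OF _ U] U by (simp add: prod_list_diag_prod lessThan_atLeast0)
    also have "\<dots> = 1" by (intro prod.neutral) (auto simp: U_def)
    finally show ?thesis .
  qed
  ultimately show ?thesis using det_mult[OF N U] by simp
qed

text \<open>
  Subtracting a multiple of the all-ones matrix moves the eigenvalue that belongs to the all-ones
  vector and leaves the rest of the spectrum alone, with multiplicities: the cofactor \<open>p\<close> does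
  not depend on \<open>s\<close>.
\<close>

lemma char_poly_const_row_sum:
  fixes a :: "nat \<Rightarrow> nat \<Rightarrow> real"
  assumes "n > 0" and row: "\<And>i. i < n \<Longrightarrow> (\<Sum>j<n. a i j) = d"
  obtains p where
    "\<And>s. char_poly (mat n n (\<lambda>(i, j). a i j - s)) = [:- (d - real n * s), 1:] * p"
proof
  fix s
  define X where "X s = char_poly_matrix (mat n n (\<lambda>(i, j). a i j - s))" for s :: real
  have X: "X s \<in> carrier_mat n n" for s by (simp add: X_def)
  have Xij: "X s $$ (i, j) = (if i = j then [:s - a i j, 1:] else [:s - a i j:])"
    if "i < n" "j < n" for s i j
    using that by (auto simp: X_def char_poly_matrix_def)
  have shift: "mat n n (\<lambda>(i, j). X 0 $$ (i, j) + [:s:]) = X s"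
    using X[of s] by (intro eq_matI) (auto simp: Xij)
  have "(\<Sum>j<n. X s $$ (i, j)) = [:- (d - real n * s), 1:]" if "i < n" for i
  proof -
    have "(\<Sum>j<n. X s $$ (i, j)) = (\<Sum>j<n. [:s - a i j:] + (if j = i then [:0, 1:] else 0))"
      using that by (intro sum.cong) (auto simp: Xij)
    also have "\<dots> = [:\<Sum>j<n. s - a i j:] + [:0, 1:]"
      using that by (simp add: sum.distrib sum_to_poly)
    also have "\<dots> = [:- (d - real n * s), 1:]"
      using row[OF that] by (simp add: sum_subtractf)
    finally show ?thesis .
  qed
  from det_const_row_sum[OF X \<open>n > 0\<close> this]
  have "det (X s) = [:- (d - real n * s), 1:] * det (ones_col (X s))" .
  also have "det (ones_col (X s)) = det (ones_col (X 0))"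
    using det_ones_col_shift[OF X, where s = "[:s:]" and s1 = 0] by (simp add: shift)
  finally show "char_poly (mat n n (\<lambda>(i, j). a i j - s))
    = [:- (d - real n * s), 1:] * det (ones_col (X 0))"
    by (simp add: X_def char_poly_def)
qed

section \<open>The Rayleigh principle\<close>

text \<open>
  Vectors of length \<open>n\<close> are sequences that vanish from \<open>n\<close> on, so that the sphere is a closed
  subset of a product of compact intervals (Tychonoff).
\<close>

lemma compact_unit_sphere_coords:
  "compact {x :: nat \<Rightarrow> real. (\<forall>i\<ge>n. x i = 0) \<and> (\<Sum>i<n. (x i)\<^sup>2) = 1}" (is "compact ?S")
proof -
  let ?C = "\<lambda>i. if i < n then {-1..1} else {0::real}"
  have "compact (PiE UNIV ?C)"
    using compactin_PiE[of "\<lambda>_. euclidean" UNIV ?C]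
    by (simp add: euclidean_product_topology)
  moreover have "closed {x :: nat \<Rightarrow> real. (\<Sum>i<n. (x i)\<^sup>2) = 1}"
    by (intro closed_Collect_eq continuous_intros continuous_on_product_coordinates)
  ultimately have "compact (PiE UNIV ?C \<inter> {x. (\<Sum>i<n. (x i)\<^sup>2) = 1})"
    by (rule compact_Int_closed)
  also have "PiE UNIV ?C \<inter> {x. (\<Sum>i<n. (x i)\<^sup>2) = 1} = ?S"
  proof (intro equalityI subsetI)
    fix x assume "x \<in> PiE UNIV ?C \<inter> {x. (\<Sum>i<n. (x i)\<^sup>2) = 1}"
    thus "x \<in> ?S" by (auto simp: PiE_def Pi_def split: if_splits) (metis not_less singletonD)+
  next
    fix x assume x: "x \<in> ?S"
    have "x i \<in> ?C i" for i
    proof (cases "i < n")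
      case True
      have "(x i)\<^sup>2 \<le> (\<Sum>i<n. (x i)\<^sup>2)"
        using True by (intro member_le_sum) auto
      thus ?thesis using x True by (simp add: abs_square_le_1 abs_le_iff)
    qed (use x in auto)
    thus "x \<in> PiE UNIV ?C \<inter> {x. (\<Sum>i<n. (x i)\<^sup>2) = 1}" using x by auto
  qed
  finally show ?thesis .
qed

lemma linear_coeff_zero:
  fixes b c :: real
  assumes "\<And>\<epsilon>. 2 * \<epsilon> * b + \<epsilon>\<^sup>2 * c \<le> 0"
  shows "b = 0"
proof (rule ccontr)
  assume "b \<noteq> 0"
  define \<epsilon> where "\<epsilon> = b / (\<bar>c\<bar> + 1)"
  have "b = \<epsilon> * (\<bar>c\<bar> + 1)"
    by (simp add: \<epsilon>_def add_pos_nonneg add.commute)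
  hence "\<epsilon> * b = \<epsilon>\<^sup>2 * \<bar>c\<bar> + \<epsilon>\<^sup>2" "\<epsilon> \<noteq> 0"
    using \<open>b \<noteq> 0\<close> by (auto simp: algebra_simps power2_eq_square)
  moreover have "\<epsilon>\<^sup>2 * \<bar>c\<bar> \<ge> 0" "\<epsilon>\<^sup>2 > 0"
    using \<open>\<epsilon> \<noteq> 0\<close> by auto
  moreover have "- (\<epsilon>\<^sup>2 * \<bar>c\<bar>) \<le> \<epsilon>\<^sup>2 * c"
    by (metis abs_ge_minus_self minus_le_iff mult_left_mono mult_minus_right zero_le_power2)
  ultimately show False using assms[of \<epsilon>] by (simp add: mult.assoc)
qed

text \<open>
  The part of the spectral theorem that is needed: the quadratic form of a symmetric matrix
  attains its maximum on the unit sphere, and a maximizer is an eigenvector because the first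
  variation in each coordinate direction vanishes there.
\<close>

lemma symmetric_form_max_eigenvector:
  fixes a :: "nat \<Rightarrow> nat \<Rightarrow> real"
  assumes "n > 0" and sym: "\<And>i j. i < n \<Longrightarrow> j < n \<Longrightarrow> a i j = a j i"
  obtains \<mu> x where "\<exists>i<n. x i \<noteq> 0" "\<And>i. i < n \<Longrightarrow> (\<Sum>j<n. a i j * x j) = \<mu> * x i"
    "\<And>y. (\<Sum>i<n. \<Sum>j<n. a i j * y i * y j) \<le> \<mu> * (\<Sum>i<n. (y i)\<^sup>2)"
proof -
  define q where "q y = (\<Sum>i<n. \<Sum>j<n. a i j * y i * y j)" for y :: "nat \<Rightarrow> real"
  define N where "N y = (\<Sum>i<n. (y i)\<^sup>2)" for y :: "nat \<Rightarrow> real"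
  define S where "S = {x :: nat \<Rightarrow> real. (\<forall>i\<ge>n. x i = 0) \<and> N x = 1}"
  have "compact S"
    unfolding S_def N_def by (rule compact_unit_sphere_coords)
  moreover have "(\<lambda>i. if i = 0 then 1 else 0) \<in> S"
    using \<open>n > 0\<close> by (auto simp: S_def N_def if_distrib[of "\<lambda>z. z ^ 2"] cong: if_cong)
  moreover have "continuous_on S q"
    unfolding q_def
    by (intro continuous_on_subset[of UNIV _ S] continuous_intros continuous_on_product_coordinates) auto
  ultimately obtain x where x: "x \<in> S" and max: "\<And>y. y \<in> S \<Longrightarrow> q y \<le> q x"
    by (metis continuous_attains_sup empty_iff)
  have Nx: "N x = 1" using x by (simp add: S_def)
  have bound: "q y \<le> q x * N y" for y
  proof (cases "N y = 0")
    case True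
    hence "\<forall>i<n. y i = 0" by (simp add: N_def sum_nonneg_eq_0_iff)
    thus ?thesis by (simp add: q_def N_def)
  next
    case False
    hence pos: "N y > 0" by (simp add: N_def less_le sum_nonneg)
    define z where "z i = (if i < n then y i / sqrt (N y) else 0)" for i
    have "N z = (\<Sum>i<n. (y i)\<^sup>2 / N y)"
      unfolding N_def[of z] using pos by (intro sum.cong) (auto simp: z_def power_divide)
    hence "z \<in> S"
      using pos by (auto simp: S_def z_def sum_divide_distrib[symmetric] N_def[of y])
    moreover have "q z = (\<Sum>i<n. \<Sum>j<n. a i j * y i * y j / N y)"
      unfolding q_def using pos by (intro sum.cong refl) (auto simp: z_def)
    hence "q z = q y / N y"
      by (simp add: sum_divide_distrib[symmetric] q_def)
    ultimately have "q y / N y \<le> q x"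
      using max[of z] by simp
    thus ?thesis using pos by (simp add: pos_divide_le_eq)
  qed
  have "(\<Sum>j<n. a i j * x j) = q x * x i" if i: "i < n" for i
  proof -
    have "2 * \<epsilon> * ((\<Sum>j<n. a i j * x j) - q x * x i) + \<epsilon>\<^sup>2 * (a i i - q x) \<le> 0" for \<epsilon>
    proof -
      define y where "y j = x j + (if j = i then \<epsilon> else 0)" for j
      have "N y = (\<Sum>j<n. (x j)\<^sup>2 + (if j = i then 2 * \<epsilon> * x i + \<epsilon>\<^sup>2 else 0))"
        unfolding N_def by (intro sum.cong) (auto simp: y_def power2_sum)
      hence Ny: "N y = 1 + 2 * \<epsilon> * x i + \<epsilon>\<^sup>2"
        using i Nx by (simp add: sum.distrib N_def)
      have row: "(\<Sum>k<n. a j k * y j * y k) = y j * ((\<Sum>k<n. a j k * x k) + a j i * \<epsilon>)" for j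
      proof -
        have "(\<Sum>k<n. a j k * y j * y k)
          = (\<Sum>k<n. y j * (a j k * x k) + (if k = i then y j * (a j i * \<epsilon>) else 0))"
          by (intro sum.cong) (auto simp: y_def algebra_simps)
        thus ?thesis using i by (simp add: sum.distrib sum_distrib_left algebra_simps)
      qed
      have "q y = (\<Sum>j<n. x j * (\<Sum>k<n. a j k * x k) + \<epsilon> * (a j i * x j)
        + (if j = i then \<epsilon> * (\<Sum>k<n. a i k * x k) + \<epsilon>\<^sup>2 * a i i else 0))"
        unfolding q_def row by (intro sum.cong) (auto simp: y_def algebra_simps power2_eq_square)
      also have "\<dots> = (\<Sum>j<n. x j * (\<Sum>k<n. a j k * x k)) + \<epsilon> * (\<Sum>j<n. a j i * x j)
        + (\<epsilon> * (\<Sum>k<n. a i k * x k) + \<epsilon>\<^sup>2 * a i i)"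
        using i by (simp add: sum.distrib sum_distrib_left)
      also have "(\<Sum>j<n. a j i * x j) = (\<Sum>j<n. a i j * x j)"
        using sym i by (intro sum.cong) auto
      also have "(\<Sum>j<n. x j * (\<Sum>k<n. a j k * x k)) = q x"
        by (simp add: q_def sum_distrib_left algebra_simps)
      finally show ?thesis
        using bound[of y] unfolding Ny by (simp add: algebra_simps)
    qed
    from linear_coeff_zero[OF this] show ?thesis by simp
  qed
  moreover have "\<exists>i<n. x i \<noteq> 0"
  proof (rule ccontr)
    assume "\<not> ?thesis"
    hence "N x = 0" by (simp add: N_def)
    thus False using Nx by simp
  qed
  ultimately show thesis
    using that[of x "q x"] bound by (simp add: q_def N_def)
qed

lemma eigenvalue_mat_iff:
  fixes a :: "nat \<Rightarrow> nat \<Rightarrow> real"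
  shows "poly (char_poly (mat n n (\<lambda>(i, j). a i j))) \<mu> = 0 \<longleftrightarrow>
    (\<exists>x. (\<exists>i<n. x i \<noteq> 0) \<and> (\<forall>i<n. (\<Sum>j<n. a i j * x j) = \<mu> * x i))"
    (is "?L \<longleftrightarrow> ?R")
proof -
  let ?A = "mat n n (\<lambda>(i, j). a i j)"
  have A: "?A \<in> carrier_mat n n" by simp
  have mult: "(?A *\<^sub>v vec n x) = \<mu> \<cdot>\<^sub>v vec n x \<longleftrightarrow> (\<forall>i<n. (\<Sum>j<n. a i j * x j) = \<mu> * x i)" for x
    by (auto simp: vec_eq_iff scalar_prod_def lessThan_atLeast0)
  have "?L \<longleftrightarrow> eigenvalue ?A \<mu>"
    using eigenvalue_root_char_poly[OF A] by simp
  also have "\<dots> \<longleftrightarrow> (\<exists>v \<in> carrier_vec n. v \<noteq> 0\<^sub>v n \<and> ?A *\<^sub>v v = \<mu> \<cdot>\<^sub>v v)"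
    by (auto simp: eigenvalue_def eigenvector_def)
  also have "\<dots> \<longleftrightarrow> (\<exists>x. vec n x \<noteq> 0\<^sub>v n \<and> ?A *\<^sub>v vec n x = \<mu> \<cdot>\<^sub>v vec n x)"
    by (metis vec_carrier carrier_vecD eq_vecI dim_vec index_vec)
  also have "\<dots> \<longleftrightarrow> ?R"
    unfolding mult by (auto simp: vec_eq_iff)
  finally show ?thesis .
qed

text \<open>
  One direction of the Courant-Fischer principle, for a vector orthogonal to the constants. The
  quadratic forms of \<open>a\<close> and of \<open>a - s\<close> agree on \<open>f\<close>; with the constant eigenvector moved
  out of the way, the largest eigenvalue of \<open>a - s\<close> is at least \<open>r\<close> and must come from the
  cofactor of the row-sum eigenvalue of \<open>a\<close>.
\<close>

lemma second_eigenvalue_ge_rayleigh: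
  fixes a :: "nat \<Rightarrow> nat \<Rightarrow> real" and f :: "nat \<Rightarrow> real"
  assumes sym: "\<And>i j. i < n \<Longrightarrow> j < n \<Longrightarrow> a i j = a j i"
    and row: "\<And>i. i < n \<Longrightarrow> (\<Sum>j<n. a i j) = d"
    and bound: "\<And>g. (\<Sum>i<n. \<Sum>j<n. a i j * g i * g j) \<le> d * (\<Sum>i<n. (g i)\<^sup>2)"
    and f0: "(\<Sum>i<n. f i) = 0" and fne: "\<exists>i<n. f i \<noteq> 0"
    and fr: "r * (\<Sum>i<n. (f i)\<^sup>2) \<le> (\<Sum>i<n. \<Sum>j<n. a i j * f i * f j)"
  shows "r \<le> second_eigenvalue (mat n n (\<lambda>(i, j). a i j))"
proof -
  have "n > 0" using fne by auto
  have pos: "(\<Sum>i<n. (g i)\<^sup>2) > 0" if "\<exists>i<n. g i \<noteq> 0" for g :: "nat \<Rightarrow> real"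
    using that by (auto intro!: sum_pos2)
  obtain p where p: "\<And>s. char_poly (mat n n (\<lambda>(i, j). a i j - s)) = [:- (d - real n * s), 1:] * p"
    using char_poly_const_row_sum[of n a d] \<open>n > 0\<close> row by blast
  have cp: "char_poly (mat n n (\<lambda>(i, j). a i j)) = [:- d, 1:] * p"
    using p[of 0] by simp
  have "p \<noteq> 0"
    using cp degree_monic_char_poly[of "mat n n (\<lambda>(i, j). a i j)" n] by auto
  have le: "x \<le> d" if "poly p x = 0" for x
  proof -
    have "poly (char_poly (mat n n (\<lambda>(i, j). a i j))) x = 0"
      using that by (simp add: cp)
    then obtain v where v: "\<exists>i<n. v i \<noteq> 0" "\<forall>i<n. (\<Sum>j<n. a i j * v j) = x * v i"
      unfolding eigenvalue_mat_iff by blast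
    have "(\<Sum>i<n. \<Sum>j<n. a i j * v i * v j) = (\<Sum>i<n. v i * (\<Sum>j<n. a i j * v j))"
      by (simp add: sum_distrib_left algebra_simps)
    also have "\<dots> = x * (\<Sum>i<n. (v i)\<^sup>2)"
      using v(2) by (simp add: sum_distrib_left power2_eq_square algebra_simps)
    finally show ?thesis
      using bound[of v] pos[OF v(1)] by simp
  qed
  \<comment> \<open>The shift moves the eigenvalue of the constant vector from \<open>d\<close> to \<open>r - 1\<close>.\<close>
  define s where "s = (d - r + 1) / real n"
  have s: "d - real n * s = r - 1"
    using \<open>n > 0\<close> by (simp add: s_def)
  obtain \<mu> x where x: "\<exists>i<n. x i \<noteq> 0" "\<And>i. i < n \<Longrightarrow> (\<Sum>j<n. (a i j - s) * x j) = \<mu> * x i"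
    and max: "\<And>y. (\<Sum>i<n. \<Sum>j<n. (a i j - s) * y i * y j) \<le> \<mu> * (\<Sum>i<n. (y i)\<^sup>2)"
  proof (rule symmetric_form_max_eigenvector[OF \<open>n > 0\<close>, of "\<lambda>i j. a i j - s"])
    show "a i j - s = a j i - s" if "i < n" "j < n" for i j using sym[OF that] by simp
  qed (rule that)
  have "(\<Sum>i<n. \<Sum>j<n. (a i j - s) * f i * f j)
      = (\<Sum>i<n. \<Sum>j<n. a i j * f i * f j) - s * (\<Sum>i<n. f i) * (\<Sum>j<n. f j)"
    unfolding mult.assoc sum_product by (simp add: sum_subtractf sum_distrib_left algebra_simps)
  hence "r * (\<Sum>i<n. (f i)\<^sup>2) \<le> \<mu> * (\<Sum>i<n. (f i)\<^sup>2)"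
    using max[of f] fr f0 by simp
  hence "r \<le> \<mu>" using pos[OF fne] by simp
  moreover have "poly (char_poly (mat n n (\<lambda>(i, j). a i j - s))) \<mu> = 0"
    using x unfolding eigenvalue_mat_iff[of n "\<lambda>i j. a i j - s"] by blast
  hence "poly [:- (r - 1), 1:] \<mu> = 0 \<or> poly p \<mu> = 0"
    unfolding p s poly_mult mult_eq_0_iff .
  ultimately have "poly p \<mu> = 0" by auto
  from second_eigenvalue_max_root(2)[OF cp \<open>p \<noteq> 0\<close> le this] \<open>r \<le> \<mu>\<close>
  show ?thesis by simp
qed

section \<open>The characteristic polynomial of \<open>Q\<close>\<close>

lemma det_mat_Suc:
  fixes f :: "nat \<times> nat \<Rightarrow> 'a::comm_ring_1"
  shows "det (mat (Suc n) (Suc n) f) = (\<Sum>j<Suc n. (- 1) ^ j * f (0, j) *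
    det (mat n n (\<lambda>(i, k). f (Suc i, if k < j then k else Suc k))))"
proof -
  let ?A = "mat (Suc n) (Suc n) f"
  have del: "mat_delete ?A 0 j = mat n n (\<lambda>(i, k). f (Suc i, if k < j then k else Suc k))"
    if "j < Suc n" for j
    using that by (intro eq_matI) (auto simp: mat_delete_def)
  have "det ?A = (\<Sum>j<Suc n. ?A $$ (0, j) * cofactor ?A 0 j)"
    by (rule laplace_expansion_row) auto
  also have "\<dots> = (\<Sum>j<Suc n. (- 1) ^ j * f (0, j) *
    det (mat n n (\<lambda>(i, k). f (Suc i, if k < j then k else Suc k))))"
    by (intro sum.cong refl) (auto simp: cofactor_def del)
  finally show ?thesis .
qed

lemma det_tridiagonal_4:
  fixes A :: "'a::comm_ring_1 mat"
  assumes A: "A \<in> carrier_mat 4 4"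
    and "A $$ (0, 2) = 0" "A $$ (0, 3) = 0" "A $$ (1, 3) = 0"
    and "A $$ (2, 0) = 0" "A $$ (3, 0) = 0" "A $$ (3, 1) = 0"
  shows "det A = (A $$ (0, 0) * A $$ (1, 1) - A $$ (0, 1) * A $$ (1, 0))
        * (A $$ (2, 2) * A $$ (3, 3) - A $$ (2, 3) * A $$ (3, 2))
      - A $$ (0, 0) * A $$ (1, 2) * A $$ (2, 1) * A $$ (3, 3)"
proof -
  have "A = mat (Suc (Suc (Suc (Suc 0)))) (Suc (Suc (Suc (Suc 0)))) (\<lambda>(i, j). A $$ (i, j))"
    using A by (intro eq_matI) auto
  hence "det A = det (mat (Suc (Suc (Suc (Suc 0)))) (Suc (Suc (Suc (Suc 0)))) (\<lambda>(i, j). A $$ (i, j)))"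
    by simp
  also have "\<dots> = (A $$ (0, 0) * A $$ (1, 1) - A $$ (0, 1) * A $$ (1, 0))
        * (A $$ (2, 2) * A $$ (3, 3) - A $$ (2, 3) * A $$ (3, 2))
      - A $$ (0, 0) * A $$ (1, 2) * A $$ (2, 1) * A $$ (3, 3)"
    using assms(2-)
    by (simp add: det_mat_Suc numeral_2_eq_2 numeral_3_eq_3 algebra_simps)
  finally show ?thesis .
qed

text \<open>
  The cofactor of \<open>t\<close> in the characteristic polynomial of \<open>Q\<close> at \<open>d - t\<close>, where \<open>k = d - 1\<close> and
  \<open>m = n - 4\<close>. The variable \<open>t\<close> is the corresponding eigenvalue of \<open>d - Q\<close>, the Laplacian of a
  path with edge weights \<open>k, 1, k\<close> and vertex masses \<open>2, 1, 1, m\<close>.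
\<close>

definition Q_cubic :: "real \<Rightarrow> real \<Rightarrow> real \<Rightarrow> real" where
  "Q_cubic k m t = t ^ 3 - (5 * k / 2 + 2 + k / m) * t\<^sup>2
     + (3 * k\<^sup>2 / 2 + 3 * k + 3 * k\<^sup>2 / (2 * m) + 2 * k / m) * t
     - k\<^sup>2 * (4 + m) / (2 * m)"

lemma char_poly_Q_matrix:
  fixes n d :: nat
  assumes "n \<ge> 5"
  defines "k \<equiv> real d - 1" and "m \<equiv> real n - 4"
  shows "poly (char_poly (Q_matrix d n)) (real d - t) = t * Q_cubic k m t"
proof -
  have m: "m \<noteq> 0" using assms by simp
  let ?Q = "Q_matrix d n"
  have Q: "?Q \<in> carrier_mat 4 4" by (intro carrier_matI) (simp_all add: Q_matrix_def mat_of_rows_list_def)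
  let ?B = "- char_matrix ?Q (real d - t)"
  have B: "?B \<in> carrier_mat 4 4" using Q by (simp add: char_matrix_def)
  have Bij: "?B $$ (i, j) = (if i = j then k + 1 - t else 0) - ?Q $$ (i, j)" if "i < 4" "j < 4" for i j
    using that Q by (auto simp: char_matrix_def k_def)
  have Qij: "?Q $$ (0, 0) = (k + 2) / 2" "?Q $$ (0, 1) = k / 2" "?Q $$ (0, 2) = 0" "?Q $$ (0, 3) = 0"
    "?Q $$ (1, 0) = k" "?Q $$ (1, 1) = 0" "?Q $$ (1, 2) = 1" "?Q $$ (1, 3) = 0"
    "?Q $$ (2, 0) = 0" "?Q $$ (2, 1) = 1" "?Q $$ (2, 2) = 0" "?Q $$ (2, 3) = k"
    "?Q $$ (3, 0) = 0" "?Q $$ (3, 1) = 0" "?Q $$ (3, 2) = k / m" "?Q $$ (3, 3) = k + 1 - k / m"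
    by (simp_all add: Q_matrix_def mat_of_rows_list_def k_def m_def)
  have Bv: "?B $$ (0, 0) = k / 2 - t" "?B $$ (0, 1) = - (k / 2)" "?B $$ (1, 0) = - k"
    "?B $$ (1, 1) = k + 1 - t" "?B $$ (1, 2) = - 1" "?B $$ (2, 1) = - 1" "?B $$ (2, 2) = k + 1 - t"
    "?B $$ (2, 3) = - k" "?B $$ (3, 2) = - (k / m)" "?B $$ (3, 3) = k / m - t"
    by (simp_all add: Bij Qij add_divide_distrib del: One_nat_def)
  have B0: "?B $$ (0, 2) = 0" "?B $$ (0, 3) = 0" "?B $$ (1, 3) = 0"
    "?B $$ (2, 0) = 0" "?B $$ (3, 0) = 0" "?B $$ (3, 1) = 0"
    by (simp_all add: Bij Qij del: One_nat_def)
  have "poly (char_poly ?Q) (real d - t) = det ?B"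
    by (rule char_poly_matrix[OF Q])
  also have "\<dots> = t * Q_cubic k m t"
    unfolding det_tridiagonal_4[OF B B0] Bv using m
    by (simp add: Q_cubic_def field_simps power2_eq_square power3_eq_cube)
  finally show ?thesis .
qed

section \<open>The second eigenvalue of \<open>Q\<close> and the test vector\<close>

lemma Q_cubic_at_1_nonneg:
  assumes "k \<ge> 1" "m \<ge> 1"
  shows "Q_cubic k m 1 \<ge> 0"
proof -
  have "2 * m * Q_cubic k m 1 = k\<^sup>2 * (m - 1) + m * (k\<^sup>2 - 1) + m * (k - 1) + 2 * k"
    using assms by (simp add: Q_cubic_def field_simps power2_eq_square power3_eq_cube)
  also have "\<dots> \<ge> 0" using assms by simp
  finally show ?thesis using assms by (simp add: zero_le_mult_iff)
qed

lemma Q_cubic_neg: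
  assumes "k \<ge> 0" "m \<ge> 1" "t < 0"
  shows "Q_cubic k m t < 0"
proof -
  have "t ^ 3 < 0" using assms by (simp add: power_less_zero_eq)
  moreover have "(5 * k / 2 + 2 + k / m) * t\<^sup>2 \<ge> 0" using assms by simp
  moreover have "(3 * k\<^sup>2 / 2 + 3 * k + 3 * k\<^sup>2 / (2 * m) + 2 * k / m) * t \<le> 0"
    using assms by (intro mult_nonneg_nonpos) auto
  moreover have "k\<^sup>2 * (4 + m) / (2 * m) \<ge> 0" using assms by simp
  ultimately show ?thesis unfolding Q_cubic_def by linarith
qed

text \<open>
  The cubic is negative for negative \<open>t\<close>, nonpositive at 0 and, unless \<open>k = 0\<close>, nonnegative at 1.
  So \<open>d\<close> is the largest eigenvalue of \<open>Q\<close> and \<open>d - \<rho> d n\<close> is the smallest root of the cubic, which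
  lies in \<open>[0, 1]\<close>.
\<close>

lemma rho_root:
  fixes n d :: nat
  assumes n: "n \<ge> 5" and d: "d \<ge> 1"
  defines "k \<equiv> real d - 1" and "m \<equiv> real n - 4"
  shows "Q_cubic k m (real d - \<rho> d n) = 0" "\<rho> d n \<le> real d" "real d - \<rho> d n \<le> 1"
proof -
  have k: "k \<ge> 0" "k = 0 \<or> k \<ge> 1" and m: "m \<ge> 1" using n d by (auto simp: k_def m_def)
  define p where "p = - pcompose [:- (k\<^sup>2 * (4 + m) / (2 * m)),
    3 * k\<^sup>2 / 2 + 3 * k + 3 * k\<^sup>2 / (2 * m) + 2 * k / m, - (5 * k / 2 + 2 + k / m), 1:] [:real d, - 1:]"
  have poly_p: "poly p x = - Q_cubic k m (real d - x)" for x
  proof -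
    have "poly (- pcompose [:- c0, c1, - c2, 1:] [:real d, - 1:]) x
      = - ((real d - x) ^ 3 - c2 * (real d - x)\<^sup>2 + c1 * (real d - x) - c0)" for c0 c1 c2
      by (simp add: poly_pcompose algebra_simps power2_eq_square power3_eq_cube)
    thus ?thesis unfolding p_def Q_cubic_def .
  qed
  have "poly (char_poly (Q_matrix d n)) x = poly ([:- real d, 1:] * p) x" for x
    using char_poly_Q_matrix[OF n, of d "real d - x"]
    by (simp add: poly_p k_def m_def algebra_simps)
  hence cp: "char_poly (Q_matrix d n) = [:- real d, 1:] * p"
    by (subst poly_eq_poly_eq_iff[symmetric]) auto
  have "p \<noteq> 0"
    using poly_p[of "real d + 1"] Q_cubic_neg[OF k(1) m, of "- 1"] by auto
  have le: "x \<le> real d" if "poly p x = 0" for x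
    using that Q_cubic_neg[OF k(1) m, of "real d - x"] by (force simp: poly_p)
  have "\<exists>t\<ge>0. t \<le> 1 \<and> Q_cubic k m t = 0"
  proof (cases "k = 0")
    case True
    thus ?thesis by (intro exI[of _ 0]) (simp add: Q_cubic_def)
  next
    case False
    have "Q_cubic k m 0 \<le> 0" using m by (simp add: Q_cubic_def)
    moreover have "Q_cubic k m 1 \<ge> 0" using False k m by (intro Q_cubic_at_1_nonneg) auto
    moreover have "isCont (Q_cubic k m) t" for t
      unfolding Q_cubic_def by (intro continuous_intros)
    ultimately show ?thesis using IVT[of "Q_cubic k m" 0 0 1] by auto
  qed
  then obtain t where t: "0 \<le> t" "t \<le> 1" "Q_cubic k m t = 0" by blast
  hence "poly p (real d - t) = 0" by (simp add: poly_p)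
  note max = second_eigenvalue_max_root[OF cp \<open>p \<noteq> 0\<close> le this, folded \<rho>_def]
  show "Q_cubic k m (real d - \<rho> d n) = 0" using max(1) by (simp add: poly_p)
  show "\<rho> d n \<le> real d" using le max(1) by blast
  show "real d - \<rho> d n \<le> 1" using max(2) t by simp
qed

text \<open>
  An eigenvector of \<open>d - Q\<close> with first entry 1 is found by solving the first three equations one
  after the other; the fourth one holds because \<open>t\<close> is a root. For \<open>t \<le> 1\<close> the solution satisfies
  \<open>0 \<le> \<beta> < 1\<close> and \<open>- 2 \<le> \<gamma> \<le> \<beta>\<close>, which bounds the last entry. The final equation says that
  the Rayleigh quotient of the weighted path is \<open>t\<close>.
\<close>

lemma Q_eigenvector:
  fixes k m t :: real
  assumes k: "k \<ge> 2" and m: "m \<ge> 1" and t: "0 \<le> t" "t \<le> 1" and root: "Q_cubic k m t = 0"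
  obtains \<beta> \<gamma> \<delta> where "2 + \<beta> + \<gamma> + m * \<delta> = 0" "\<beta> < 1" "- 4 \<le> m * \<delta>" "\<delta> \<le> 0"
    "k * (1 - \<beta>)\<^sup>2 + (\<beta> - \<gamma>)\<^sup>2 + k * (\<gamma> - \<delta>)\<^sup>2 = t * (2 + \<beta>\<^sup>2 + \<gamma>\<^sup>2 + m * \<delta>\<^sup>2)"
proof -
  define \<beta> where "\<beta> = 1 - 2 * t / k"
  define \<gamma> where "\<gamma> = \<beta> - t * (2 + \<beta>)"
  define \<delta> where "\<delta> = - (2 + \<beta> + \<gamma>) / m"
  have "t \<noteq> 0"
    using root k m by (auto simp: Q_cubic_def)
  hence t0: "t > 0" using t by simp
  have \<beta>: "0 \<le> \<beta>" "\<beta> < 1" using t0 t k by (auto simp: \<beta>_def field_simps)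
  have "t * (2 + \<beta>) \<le> 1 * (2 + \<beta>)" using t \<beta> by (intro mult_right_mono) auto
  hence \<gamma>: "- 2 \<le> \<gamma>" by (simp add: \<gamma>_def)
  have \<gamma>': "\<gamma> \<le> \<beta>" using t \<beta> by (simp add: \<gamma>_def)
  have m\<delta>: "m * \<delta> = - (2 + \<beta> + \<gamma>)" using m by (simp add: \<delta>_def)
  \<comment> \<open>The flow over each edge of the path is \<open>t\<close> times the weighted sum of the entries before it.\<close>
  have e1: "k * (1 - \<beta>) = 2 * t" using k by (simp add: \<beta>_def)
  have e2: "\<beta> - \<gamma> = t * (2 + \<beta>)" by (simp add: \<gamma>_def)
  have e3: "k * (\<gamma> - \<delta>) = t * (2 + \<beta> + \<gamma>)"
  proof -
    have "k * (m * (k * (\<gamma> - \<delta>) - t * (2 + \<beta> + \<gamma>))) = - 2 * m * Q_cubic k m t"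
      using k m unfolding \<delta>_def \<gamma>_def \<beta>_def Q_cubic_def
      by (simp add: field_simps power2_eq_square power3_eq_cube)
    hence "k * (m * (k * (\<gamma> - \<delta>) - t * (2 + \<beta> + \<gamma>))) = 0" using root by simp
    thus ?thesis using k m by simp
  qed
  have "k * (1 - \<beta>)\<^sup>2 + (\<beta> - \<gamma>)\<^sup>2 + k * (\<gamma> - \<delta>)\<^sup>2
    = k * (1 - \<beta>) * (1 - \<beta>) + (\<beta> - \<gamma>) * (\<beta> - \<gamma>) + k * (\<gamma> - \<delta>) * (\<gamma> - \<delta>)"
    by (simp add: power2_eq_square)
  also have "\<dots> = 2 * t * (1 - \<beta>) + t * (2 + \<beta>) * (\<beta> - \<gamma>) + t * (2 + \<beta> + \<gamma>) * (\<gamma> - \<delta>)"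
    unfolding e1 e3 by (subst e2) simp
  also have "\<dots> = t * (2 + \<beta>\<^sup>2 + \<gamma>\<^sup>2 - (2 + \<beta> + \<gamma>) * \<delta>)"
    by (simp add: algebra_simps power2_eq_square)
  also have "(2 + \<beta> + \<gamma>) * \<delta> = - (m * \<delta>\<^sup>2)"
    unfolding power2_eq_square mult.assoc[symmetric] m\<delta> by (simp add: algebra_simps)
  finally have "k * (1 - \<beta>)\<^sup>2 + (\<beta> - \<gamma>)\<^sup>2 + k * (\<gamma> - \<delta>)\<^sup>2
    = t * (2 + \<beta>\<^sup>2 + \<gamma>\<^sup>2 + m * \<delta>\<^sup>2)" by simp
  moreover have "\<delta> \<le> 0"
    unfolding \<delta>_def using \<beta> \<gamma> m by (intro divide_nonpos_pos) auto
  ultimately show thesis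
    using that[of \<beta> \<gamma> \<delta>] m\<delta> \<beta> \<gamma>' by linarith
qed

text \<open>
  For a bridge whose sides have \<open>p + 1\<close> and \<open>q + 1\<close> vertices, the masses of the weighted path are
  \<open>p, 1, 1, q\<close> instead of \<open>2, 1, 1, m\<close>. The eigenvector for the latter is used as a test vector for
  the former, after subtracting its mean \<open>c\<close>. Its energy does not change, so it remains to see that
  its variance does not decrease when mass \<open>s = p - 2\<close> is carried from the last vertex, with value
  \<open>\<delta>\<close>, to the first one, with value 1. The change is \<open>s * (1 - \<delta>\<^sup>2) - s\<^sup>2 * (1 - \<delta>)\<^sup>2 / n\<close>, which is
  nonnegative by \<open>- 4 / m \<le> \<delta> \<le> 0\<close> as soon as \<open>s = 0\<close> or \<open>q \<ge> 4\<close>.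
\<close>

lemma bridge_test_values_aux:
  fixes n d p q :: nat
  assumes d: "d \<ge> 3" and pq: "p + q + 2 = n" and p: "p = 2 \<and> q \<ge> 2 \<or> p \<ge> 2 \<and> q \<ge> 4"
  obtains \<alpha> \<beta> \<gamma> \<delta> :: real where "real p * \<alpha> + \<beta> + \<gamma> + real q * \<delta> = 0" "\<alpha> \<noteq> \<beta>"
    "(real d - 1) * (\<alpha> - \<beta>)\<^sup>2 + (\<beta> - \<gamma>)\<^sup>2 + (real d - 1) * (\<gamma> - \<delta>)\<^sup>2
      \<le> (real d - \<rho> d n) * (real p * \<alpha>\<^sup>2 + \<beta>\<^sup>2 + \<gamma>\<^sup>2 + real q * \<delta>\<^sup>2)"
proof -
  have n: "n \<ge> 5" using pq p by auto
  define k where "k = real d - 1"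
  define m where "m = real n - 4"
  define t where "t = real d - \<rho> d n"
  define s where "s = real p - 2"
  have k: "k \<ge> 2" and m: "m \<ge> 1" using d n by (auto simp: k_def m_def)
  have t: "0 \<le> t" "t \<le> 1" "Q_cubic k m t = 0"
    using rho_root[of n d] n d by (auto simp: k_def m_def t_def)
  obtain \<beta> \<gamma> \<delta> where sum0: "2 + \<beta> + \<gamma> + m * \<delta> = 0" and "\<beta> < 1"
    and \<delta>: "- 4 \<le> m * \<delta>" "\<delta> \<le> 0"
    and en: "k * (1 - \<beta>)\<^sup>2 + (\<beta> - \<gamma>)\<^sup>2 + k * (\<gamma> - \<delta>)\<^sup>2 = t * (2 + \<beta>\<^sup>2 + \<gamma>\<^sup>2 + m * \<delta>\<^sup>2)"
    using Q_eigenvector[OF k m t] by blast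
  define N where "N = real n"
  \<comment> \<open>Since \<open>q = N - 4 - s\<close>, the bound \<open>s \<le> N - 8\<close> is the hypothesis \<open>q \<ge> 4\<close>.\<close>
  have N: "N > 0" "m = N - 4" "real p = s + 2" "real q = N - 4 - s" and s: "s = 0 \<or> s \<le> N - 8" "s \<ge> 0"
    using pq p by (auto simp: N_def m_def s_def)
  define c where "c = s * (1 - \<delta>) / N"
  have Nc: "N * c = s * (1 - \<delta>)" using N by (simp add: c_def)
  have gain: "s * (1 - \<delta>\<^sup>2) \<ge> c * (N * c)"
  proof (cases "s = 0")
    case False
    have "s * N \<le> (N - 8) * N" using s False N by (intro mult_right_mono) auto
    hence "4 * (N + s) \<le> (N - s) * m" unfolding N(2) by (simp add: algebra_simps)
    moreover have "- 4 * (N + s) \<le> m * \<delta> * (N + s)" using \<delta> N s by (intro mult_right_mono) auto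
    ultimately have "m * (N - s + \<delta> * (N + s)) \<ge> 0" by (simp add: algebra_simps)
    hence "N - s + \<delta> * (N + s) \<ge> 0" using m by (simp add: zero_le_mult_iff)
    hence "s * (1 - \<delta>) \<le> N * (1 + \<delta>)" by (simp add: algebra_simps)
    hence "c \<le> 1 + \<delta>" using N by (simp add: c_def field_simps)
    hence "c * (s * (1 - \<delta>)) \<le> (1 + \<delta>) * (s * (1 - \<delta>))"
      using s \<delta> by (intro mult_right_mono) auto
    thus ?thesis unfolding Nc by (simp add: power2_eq_square algebra_simps)
  qed (simp add: c_def)
  show thesis
  proof (rule that[of "1 - c" "\<beta> - c" "\<gamma> - c" "\<delta> - c"])
    have "real p * (1 - c) + (\<beta> - c) + (\<gamma> - c) + real q * (\<delta> - c)
      = (2 + \<beta> + \<gamma> + m * \<delta>) + s * (1 - \<delta>) - N * c"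
      unfolding N by (simp add: algebra_simps)
    thus "real p * (1 - c) + (\<beta> - c) + (\<gamma> - c) + real q * (\<delta> - c) = 0"
      using sum0 Nc by simp
    show "1 - c \<noteq> \<beta> - c" using \<open>\<beta> < 1\<close> by simp
    have "real p * (1 - c)\<^sup>2 + (\<beta> - c)\<^sup>2 + (\<gamma> - c)\<^sup>2 + real q * (\<delta> - c)\<^sup>2
      = (2 + \<beta>\<^sup>2 + \<gamma>\<^sup>2 + m * \<delta>\<^sup>2) + s * (1 - \<delta>\<^sup>2)
        - 2 * c * ((2 + \<beta> + \<gamma> + m * \<delta>) + s * (1 - \<delta>)) + c * (N * c)"
      unfolding N by (simp add: algebra_simps power2_eq_square)
    also have "\<dots> = (2 + \<beta>\<^sup>2 + \<gamma>\<^sup>2 + m * \<delta>\<^sup>2) + (s * (1 - \<delta>\<^sup>2) - c * (N * c))"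
      unfolding sum0 Nc[symmetric] by (simp add: algebra_simps)
    finally have "2 + \<beta>\<^sup>2 + \<gamma>\<^sup>2 + m * \<delta>\<^sup>2
      \<le> real p * (1 - c)\<^sup>2 + (\<beta> - c)\<^sup>2 + (\<gamma> - c)\<^sup>2 + real q * (\<delta> - c)\<^sup>2"
      using gain by simp
    from mult_left_mono[OF this t(1)]
    show "(real d - 1) * (1 - c - (\<beta> - c))\<^sup>2 + (\<beta> - c - (\<gamma> - c))\<^sup>2 + (real d - 1) * (\<gamma> - c - (\<delta> - c))\<^sup>2
      \<le> (real d - \<rho> d n) * (real p * (1 - c)\<^sup>2 + (\<beta> - c)\<^sup>2 + (\<gamma> - c)\<^sup>2 + real q * (\<delta> - c)\<^sup>2)"
      using en by (simp add: k_def t_def)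
  qed
qed

text \<open>
  Parity leaves only \<open>p = 2\<close>, \<open>q = 2\<close>, and the case where both are at least 4; the second one
  is the mirror image of the first.
\<close>

lemma bridge_test_values:
  fixes n d p q :: nat
  assumes d: "d \<ge> 3" and pq: "p + q + 2 = n" and "even p" "even q" "p \<ge> 2" "q \<ge> 2"
  obtains \<alpha> \<beta> \<gamma> \<delta> :: real where "real p * \<alpha> + \<beta> + \<gamma> + real q * \<delta> = 0"
    "\<alpha> \<noteq> \<beta> \<or> \<gamma> \<noteq> \<delta>"
    "(real d - 1) * (\<alpha> - \<beta>)\<^sup>2 + (\<beta> - \<gamma>)\<^sup>2 + (real d - 1) * (\<gamma> - \<delta>)\<^sup>2
      \<le> (real d - \<rho> d n) * (real p * \<alpha>\<^sup>2 + \<beta>\<^sup>2 + \<gamma>\<^sup>2 + real q * \<delta>\<^sup>2)"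
proof (cases "p = 2 \<or> q \<ge> 4")
  case True
  hence "p = 2 \<and> q \<ge> 2 \<or> p \<ge> 2 \<and> q \<ge> 4" using assms by auto
  from bridge_test_values_aux[OF d pq this] that show thesis by metis
next
  case False
  have "q \<noteq> 3" using \<open>even q\<close> by auto
  hence q: "q = 2 \<and> p \<ge> 2 \<or> q \<ge> 2 \<and> p \<ge> 4" using False assms by auto
  have qp: "q + p + 2 = n" using pq by simp
  from bridge_test_values_aux[OF d qp q] obtain \<alpha> \<beta> \<gamma> \<delta> :: real where
    "real q * \<alpha> + \<beta> + \<gamma> + real p * \<delta> = 0" "\<alpha> \<noteq> \<beta>"
    "(real d - 1) * (\<alpha> - \<beta>)\<^sup>2 + (\<beta> - \<gamma>)\<^sup>2 + (real d - 1) * (\<gamma> - \<delta>)\<^sup>2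
      \<le> (real d - \<rho> d n) * (real q * \<alpha>\<^sup>2 + \<beta>\<^sup>2 + \<gamma>\<^sup>2 + real p * \<delta>\<^sup>2)"
    by metis
  thus thesis
    using that[of \<delta> \<gamma> \<beta> \<alpha>] by (simp add: power2_commute add_ac)
qed

section \<open>Energy and cuts of regular multigraphs\<close>

text \<open>
  This is \<open>(f a - f b)\<^sup>2\<close> for an edge with ends \<open>a\<close> and \<open>b\<close>. The double sum avoids choosing an
  order of the two ends and counts each pair twice.
\<close>

definition edge_energy :: "('v, 'e) mgraph \<Rightarrow> ('v \<Rightarrow> real) \<Rightarrow> 'e \<Rightarrow> real" where
  "edge_energy G f e = (\<Sum>u\<in>ends G e. \<Sum>v\<in>ends G e. (f u - f v)\<^sup>2) / 2"

definition cut :: "('v, 'e) mgraph \<Rightarrow> 'v set \<Rightarrow> 'e set" where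
  "cut G S = {e \<in> edges G. ends G e \<inter> S \<noteq> {} \<and> \<not> ends G e \<subseteq> S}"

lemma edge_energy_doubleton:
  assumes "ends G e = {a, b}" "a \<noteq> b"
  shows "edge_energy G f e = (f a - f b)\<^sup>2"
  using assms by (simp add: edge_energy_def power2_commute)

lemma edge_energy_nonneg: "edge_energy G f e \<ge> 0"
  by (simp add: edge_energy_def sum_nonneg)

lemma of_nat_card_filter:
  assumes "finite E"
  shows "of_nat (card {e \<in> E. P e}) = (\<Sum>e\<in>E. if P e then 1 else 0 :: 'a::semiring_1)"
  using assms by (simp add: sum.If_cases Int_def)

context multigraph
begin

lemma ends_doubleton:
  assumes "e \<in> edges G"
  obtains a b where "ends G e = {a, b}" "a \<noteq> b" "a \<in> verts G" "b \<in> verts G"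
  using no_loops[OF assms] ends_subset[OF assms] by (auto simp: card_2_iff)

lemma sum_multiplicity:
  assumes "u \<in> verts G"
  shows "(\<Sum>v\<in>verts G. real (card {e \<in> edges G. ends G e = {u, v}})) = real (vertex_degree G u)"
proof -
  have "(\<Sum>v\<in>verts G. real (card {e \<in> edges G. ends G e = {u, v}}))
    = (\<Sum>e\<in>edges G. \<Sum>v\<in>verts G. if ends G e = {u, v} then 1 else 0)"
    unfolding of_nat_card_filter[OF finite_edges] by (rule sum.swap)
  also have "\<dots> = (\<Sum>e\<in>edges G. if u \<in> ends G e then 1 else 0)"
  proof (intro sum.cong refl)
    fix e assume "e \<in> edges G"
    then obtain a b where ab: "ends G e = {a, b}" "a \<noteq> b" "a \<in> verts G" "b \<in> verts G"
      by (rule ends_doubleton)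
    have "(\<Sum>v\<in>verts G. if ends G e = {u, v} then 1 else 0 :: real)
      = (\<Sum>v\<in>verts G. (if v = b then (if u = a then 1 else 0) else 0)
          + (if v = a then (if u = b then 1 else 0) else 0))"
      using ab by (intro sum.cong) (auto simp: doubleton_eq_iff)
    also have "\<dots> = (if u \<in> ends G e then 1 else 0)"
      using ab finite_verts by (simp add: sum.distrib)
    finally show "(\<Sum>v\<in>verts G. if ends G e = {u, v} then 1 else 0 :: real)
      = (if u \<in> ends G e then 1 else 0)" .
  qed
  finally show ?thesis
    unfolding vertex_degree_def of_nat_card_filter[OF finite_edges] .
qed

lemma sum_degree_weighted:
  "(\<Sum>v\<in>verts G. g v * real (vertex_degree G v)) = (\<Sum>e\<in>edges G. \<Sum>v\<in>ends G e. g v)"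
proof -
  have "(\<Sum>v\<in>verts G. g v * real (vertex_degree G v))
    = (\<Sum>v\<in>verts G. \<Sum>e\<in>edges G. if v \<in> ends G e then g v else 0)"
    unfolding vertex_degree_def of_nat_card_filter[OF finite_edges] sum_distrib_left
    by (intro sum.cong) auto
  also have "\<dots> = (\<Sum>e\<in>edges G. \<Sum>v\<in>verts G. if v \<in> ends G e then g v else 0)"
    by (rule sum.swap)
  also have "\<dots> = (\<Sum>e\<in>edges G. \<Sum>v\<in>ends G e. g v)"
  proof (rule sum.cong[OF refl])
    fix e assume "e \<in> edges G"
    thus "(\<Sum>v\<in>verts G. if v \<in> ends G e then g v else 0) = (\<Sum>v\<in>ends G e. g v)"
      using sum.inter_restrict[OF finite_verts, of g "ends G e"] ends_subset
      by (simp add: Int_absorb1)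
  qed
  finally show ?thesis .
qed

text \<open>
  The Laplacian identity: \<open>d\<close> minus the adjacency matrix is the sum over all edges of the squared
  differences.
\<close>

lemma adjacency_form_eq_energy:
  assumes "regular G d"
  shows "(\<Sum>u\<in>verts G. \<Sum>v\<in>verts G. real (card {e \<in> edges G. ends G e = {u, v}}) * f u * f v)
    = real d * (\<Sum>v\<in>verts G. (f v)\<^sup>2) - (\<Sum>e\<in>edges G. edge_energy G f e)"
proof -
  have "(\<Sum>u\<in>verts G. \<Sum>v\<in>verts G. real (card {e \<in> edges G. ends G e = {u, v}}) * f u * f v)
    = (\<Sum>u\<in>verts G. \<Sum>v\<in>verts G. \<Sum>e\<in>edges G. if ends G e = {u, v} then f u * f v else 0)"
    unfolding of_nat_card_filter[OF finite_edges] sum_distrib_right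
    by (intro sum.cong) auto
  also have "\<dots> = (\<Sum>e\<in>edges G. \<Sum>u\<in>verts G. \<Sum>v\<in>verts G. if ends G e = {u, v} then f u * f v else 0)"
    by (subst sum.swap[of _ "edges G"], subst sum.swap[of _ _ "edges G"]) (rule refl)
  also have "\<dots> = (\<Sum>e\<in>edges G. (\<Sum>v\<in>ends G e. (f v)\<^sup>2) - edge_energy G f e)"
  proof (intro sum.cong refl)
    fix e assume "e \<in> edges G"
    then obtain a b where ab: "ends G e = {a, b}" "a \<noteq> b" "a \<in> verts G" "b \<in> verts G"
      by (rule ends_doubleton)
    have "(\<Sum>v\<in>verts G. if ends G e = {u, v} then f u * f v else 0)
      = (if u = a then f a * f b else 0) + (if u = b then f a * f b else 0)" for u
    proof -
      have "(\<Sum>v\<in>verts G. if ends G e = {u, v} then f u * f v else 0)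
        = (\<Sum>v\<in>verts G. (if v = b then (if u = a then f a * f b else 0) else 0)
          + (if v = a then (if u = b then f a * f b else 0) else 0))"
        using ab by (intro sum.cong) (auto simp: doubleton_eq_iff)
      thus ?thesis using ab finite_verts by (simp add: sum.distrib)
    qed
    hence "(\<Sum>u\<in>verts G. \<Sum>v\<in>verts G. if ends G e = {u, v} then f u * f v else 0) = 2 * (f a * f b)"
      using ab finite_verts by (simp add: sum.distrib)
    also have "\<dots> = (\<Sum>v\<in>ends G e. (f v)\<^sup>2) - edge_energy G f e"
      unfolding edge_energy_doubleton[OF ab(1,2)] using ab by (simp add: power2_diff)
    finally show "(\<Sum>u\<in>verts G. \<Sum>v\<in>verts G. if ends G e = {u, v} then f u * f v else 0)
      = (\<Sum>v\<in>ends G e. (f v)\<^sup>2) - edge_energy G f e" .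
  qed
  also have "\<dots> = (\<Sum>v\<in>verts G. (f v)\<^sup>2 * real (vertex_degree G v)) - (\<Sum>e\<in>edges G. edge_energy G f e)"
    unfolding sum_degree_weighted by (rule sum_subtractf)
  also have "(\<Sum>v\<in>verts G. (f v)\<^sup>2 * real (vertex_degree G v)) = real d * (\<Sum>v\<in>verts G. (f v)\<^sup>2)"
    using assms by (simp add: regular_def sum_distrib_left mult.commute)
  finally show ?thesis .
qed

text \<open>
  The variational bound in terms of functions on the vertices. It applies since the energy is
  nonnegative, so that no eigenvalue exceeds \<open>d\<close>.
\<close>

lemma second_eigenvalue_ge_energy:
  assumes reg: "regular G d" and vs: "distinct vs" "set vs = verts G"
    and f0: "(\<Sum>v\<in>verts G. f v) = 0" and fne: "\<exists>v\<in>verts G. f v \<noteq> 0"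
    and fr: "(\<Sum>e\<in>edges G. edge_energy G f e) \<le> (real d - r) * (\<Sum>v\<in>verts G. (f v)\<^sup>2)"
  shows "r \<le> second_eigenvalue (adjacency_matrix G vs)"
proof -
  define n where "n = length vs"
  define a where "a i j = real (card {e \<in> edges G. ends G e = {vs ! i, vs ! j}})" for i j
  have bij: "bij_betw ((!) vs) {..<n} (verts G)"
    using bij_betw_nth[OF vs(1), of "{..<n}" "verts G"] vs(2) by (simp add: n_def)
  have re: "(\<Sum>i<n. g (vs ! i)) = (\<Sum>v\<in>verts G. g v)" for g :: "'v \<Rightarrow> real"
    by (rule sum.reindex_bij_betw[OF bij])
  have form: "(\<Sum>i<n. \<Sum>j<n. a i j * f (vs ! i) * f (vs ! j))
    = real d * (\<Sum>v\<in>verts G. (f v)\<^sup>2) - (\<Sum>e\<in>edges G. edge_energy G f e)" for f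
  proof -
    let ?c = "\<lambda>u v. real (card {e \<in> edges G. ends G e = {u, v}}) * f u * f v"
    have "(\<Sum>i<n. \<Sum>j<n. ?c (vs ! i) (vs ! j)) = (\<Sum>u\<in>verts G. \<Sum>j<n. ?c u (vs ! j))"
      by (rule re)
    also have "\<dots> = (\<Sum>u\<in>verts G. \<Sum>v\<in>verts G. ?c u v)"
      by (intro sum.cong refl re)
    finally show ?thesis unfolding a_def adjacency_form_eq_energy[OF reg] .
  qed
  have "r \<le> second_eigenvalue (mat n n (\<lambda>(i, j). a i j))"
  proof (rule second_eigenvalue_ge_rayleigh[where a = a and n = n and d = "real d" and f = "\<lambda>i. f (vs ! i)"])
    show "a i j = a j i" for i j
      unfolding a_def by (subst insert_commute) (rule refl)
    show "(\<Sum>j<n. a i j) = real d" if "i < n" for i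
    proof -
      have "vs ! i \<in> verts G" using that unfolding n_def vs(2)[symmetric] by (rule nth_mem)
      hence "(\<Sum>v\<in>verts G. real (card {e \<in> edges G. ends G e = {vs ! i, v}})) = real d"
        using reg by (simp add: sum_multiplicity regular_def)
      thus ?thesis
        unfolding a_def using re[of "\<lambda>v. real (card {e \<in> edges G. ends G e = {vs ! i, v}})"] by simp
    qed
    show "(\<Sum>i<n. \<Sum>j<n. a i j * g i * g j) \<le> real d * (\<Sum>i<n. (g i)\<^sup>2)" for g
    proof -
      define h where "h v = g (the_inv_into {..<n} ((!) vs) v)" for v
      have h: "h (vs ! i) = g i" if "i < n" for i
        using that bij by (simp add: h_def the_inv_into_f_f bij_betw_def)
      have "(\<Sum>i<n. \<Sum>j<n. a i j * g i * g j) = (\<Sum>i<n. \<Sum>j<n. a i j * h (vs ! i) * h (vs ! j))"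
        by (simp add: h)
      also have "\<dots> \<le> real d * (\<Sum>v\<in>verts G. (h v)\<^sup>2)"
        unfolding form[of h] by (simp add: sum_nonneg edge_energy_nonneg)
      also have "\<dots> = real d * (\<Sum>i<n. (g i)\<^sup>2)"
        unfolding re[of "\<lambda>v. (h v)\<^sup>2", symmetric] by (simp add: h)
      finally show ?thesis .
    qed
    show "(\<Sum>i<n. f (vs ! i)) = 0" using f0 re[of f] by simp
    show "\<exists>i<n. f (vs ! i) \<noteq> 0"
      using fne unfolding vs(2)[symmetric] n_def by (auto simp: in_set_conv_nth)
    show "r * (\<Sum>i<n. (f (vs ! i))\<^sup>2) \<le> (\<Sum>i<n. \<Sum>j<n. a i j * f (vs ! i) * f (vs ! j))"
      unfolding form[of f] re[of "\<lambda>v. (f v)\<^sup>2"] using fr by (simp add: algebra_simps)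
  qed
  thus ?thesis unfolding adjacency_matrix_def n_def a_def .
qed

text \<open>
  A function that is constant on each side of an empty cut has energy 0; the two values are chosen
  to make its sum 0.
\<close>

lemma second_eigenvalue_ge_degree:
  assumes reg: "regular G d" and vs: "distinct vs" "set vs = verts G"
    and S: "S \<subseteq> verts G" "S \<noteq> {}" "S \<noteq> verts G" and cut: "cut G S = {}"
  shows "real d \<le> second_eigenvalue (adjacency_matrix G vs)"
proof -
  let ?T = "verts G - S"
  define f where "f v = (if v \<in> S then real (card ?T) else - real (card S))" for v
  have fin: "finite S" "finite ?T" using finite_verts S by (auto intro: finite_subset)
  have split: "(\<Sum>v\<in>verts G. g v) = (\<Sum>v\<in>S. g v) + (\<Sum>v\<in>?T. g v)" for g :: "'v \<Rightarrow> real"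
    using sum.subset_diff[OF S(1) finite_verts, of g] by simp
  show ?thesis
  proof (rule second_eigenvalue_ge_energy[OF reg vs])
    show "(\<Sum>v\<in>verts G. f v) = 0"
      unfolding split by (simp add: f_def)
    show "\<exists>v\<in>verts G. f v \<noteq> 0"
    proof -
      obtain v where "v \<in> S" using S by auto
      moreover have "card ?T \<noteq> 0" using S fin by auto
      ultimately show ?thesis using S by (intro bexI[of _ v]) (auto simp: f_def)
    qed
    have "edge_energy G f e = 0" if e: "e \<in> edges G" for e
    proof -
      obtain a b where ab: "ends G e = {a, b}" "a \<noteq> b" using e by (metis ends_doubleton)
      have "e \<notin> cut G S" using cut by simp
      hence "a \<in> S \<longleftrightarrow> b \<in> S" using e ab by (auto simp: cut_def)
      thus ?thesis unfolding edge_energy_doubleton[OF ab] by (simp add: f_def)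
    qed
    thus "(\<Sum>e\<in>edges G. edge_energy G f e) \<le> (real d - real d) * (\<Sum>v\<in>verts G. (f v)\<^sup>2)"
      by simp
  qed
qed

text \<open>
  Counting the pairs of a vertex in \<open>S\<close> and an edge at it: edges inside \<open>S\<close> contribute two, edges of
  the cut one.
\<close>

lemma regular_cut_parity:
  assumes reg: "regular G d" and S: "S \<subseteq> verts G"
  shows "card S * d = 2 * card {e \<in> edges G. ends G e \<subseteq> S} + card (cut G S)"
proof -
  have "real (card S * d) = (\<Sum>v\<in>verts G. (if v \<in> S then 1 else 0) * real (vertex_degree G v))"
    using reg S finite_verts
    by (simp add: regular_def if_distrib[of "\<lambda>z. z * _"] sum.inter_restrict[symmetric]
        Int_absorb1 cong: if_cong)
  also have "\<dots> = (\<Sum>e\<in>edges G. \<Sum>v\<in>ends G e. if v \<in> S then 1 else 0)"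
    by (rule sum_degree_weighted)
  also have "\<dots> = (\<Sum>e\<in>edges G. 2 * (if ends G e \<subseteq> S then 1 else 0)
    + (if ends G e \<inter> S \<noteq> {} \<and> \<not> ends G e \<subseteq> S then 1 else 0))"
  proof (intro sum.cong refl)
    fix e assume "e \<in> edges G"
    then obtain a b where "ends G e = {a, b}" "a \<noteq> b" by (metis ends_doubleton)
    thus "(\<Sum>v\<in>ends G e. if v \<in> S then 1 else 0) = 2 * (if ends G e \<subseteq> S then 1 else 0)
      + (if ends G e \<inter> S \<noteq> {} \<and> \<not> ends G e \<subseteq> S then 1 else 0 :: real)"
      by auto
  qed
  also have "\<dots> = real (2 * card {e \<in> edges G. ends G e \<subseteq> S} + card (cut G S))"
    unfolding cut_def of_nat_add of_nat_mult of_nat_card_filter[OF finite_edges]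
    by (simp add: sum.distrib sum_distrib_left)
  finally show ?thesis by linarith
qed

text \<open>
  The parity of the degree sum makes \<open>d\<close> and \<open>card S\<close> odd, and a side that consists of a single
  vertex would have the bridge as its only edge.
\<close>

lemma bridge_side:
  assumes reg: "regular G d" and "d \<noteq> 1" and S: "S \<subseteq> verts G"
    and cut: "cut G S = {e}" and x: "x \<in> S" "x \<in> ends G e"
  shows "odd d" "odd (card S)" "card S \<ge> 3"
proof -
  have "odd (card S * d)" using regular_cut_parity[OF reg S] cut by simp
  thus odd: "odd d" "odd (card S)" by auto
  have "card S \<noteq> 1"
  proof
    assume "card S = 1"
    hence Sx: "S = {x}" using x by (auto simp: card_1_singleton_iff)
    have e: "e \<in> edges G" using cut by (auto simp: cut_def)
    have "e' = e" if e': "e' \<in> edges G" "x \<in> ends G e'" for e'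
    proof -
      obtain a b where "ends G e' = {a, b}" "a \<noteq> b" using e'(1) by (metis ends_doubleton)
      hence "e' \<in> cut G S" using e' Sx by (auto simp: cut_def)
      thus ?thesis by (simp add: cut)
    qed
    hence "{e' \<in> edges G. x \<in> ends G e'} = {e}" using e x by blast
    hence "vertex_degree G x = 1" by (simp add: vertex_degree_def)
    thus False using reg S x \<open>d \<noteq> 1\<close> by (auto simp: regular_def)
  qed
  thus "card S \<ge> 3" using odd(2) by (cases "card S = 2") (auto elim: oddE)
qed

text \<open>
  The four values are placed on \<open>S - {x}\<close>, \<open>x\<close>, \<open>y\<close> and the rest, where \<open>x\<close> and \<open>y\<close> are the ends of the
  bridge. Only these edges can have different values at their ends: the bridge, and the other \<open>d - 1\<close> edges at each
  of \<open>x\<close> and \<open>y\<close>. So the energy of this function is that of the weighted path.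
\<close>

lemma second_eigenvalue_ge_rho_of_bridge:
  assumes reg: "regular G d" and vs: "distinct vs" "set vs = verts G"
    and "d \<ge> 1" "d \<noteq> 1"
    and S: "S \<subseteq> verts G" and cut: "cut G S = {e0}"
  shows "\<rho> d (card (verts G)) \<le> second_eigenvalue (adjacency_matrix G vs)"
proof -
  let ?T = "verts G - S"
  define n where "n = card (verts G)"
  have fin: "finite S" "finite ?T" using finite_verts S by (auto intro: finite_subset)
  have e0: "e0 \<in> edges G" using cut by (auto simp: cut_def)
  obtain x y where xy: "ends G e0 = {x, y}" "x \<in> S" "y \<in> ?T"
  proof -
    obtain a b where "ends G e0 = {a, b}" "a \<in> verts G" "b \<in> verts G"
      using e0 by (metis ends_doubleton)
    moreover have "ends G e0 \<inter> S \<noteq> {}" "\<not> ends G e0 \<subseteq> S" using cut by (auto simp: cut_def)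
    ultimately show thesis using that[of a b] that[of b a] by (auto simp: doubleton_eq_iff)
  qed
  have "cut G ?T = cut G S"
    using ends_subset by (auto simp: cut_def)
  hence cutT: "cut G ?T = {e0}" using cut by simp
  note sideS = bridge_side[OF reg \<open>d \<noteq> 1\<close> S cut \<open>x \<in> S\<close>]
  note sideT = bridge_side[OF reg \<open>d \<noteq> 1\<close> Diff_subset cutT \<open>y \<in> ?T\<close>]
  have odd: "odd d" "odd (card S)" "card S \<ge> 3" "odd (card ?T)" "card ?T \<ge> 3"
    using sideS sideT xy by auto
  have d3: "d \<ge> 3" using odd(1) assms(4,5) by (cases "d = 2") auto
  define p q where "p = card S - 1" and "q = card ?T - 1"
  have "card S + card ?T = n"
    using card_Diff_subset[OF fin(1) S] card_mono[OF finite_verts S] by (simp add: n_def)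
  hence pq: "p + q + 2 = n" "even p" "even q" "p \<ge> 2" "q \<ge> 2"
    using odd by (auto simp: p_def q_def)
  obtain \<alpha> \<beta> \<gamma> \<delta> :: real where sum0: "real p * \<alpha> + \<beta> + \<gamma> + real q * \<delta> = 0"
    and ne: "\<alpha> \<noteq> \<beta> \<or> \<gamma> \<noteq> \<delta>"
    and en: "(real d - 1) * (\<alpha> - \<beta>)\<^sup>2 + (\<beta> - \<gamma>)\<^sup>2 + (real d - 1) * (\<gamma> - \<delta>)\<^sup>2
      \<le> (real d - \<rho> d n) * (real p * \<alpha>\<^sup>2 + \<beta>\<^sup>2 + \<gamma>\<^sup>2 + real q * \<delta>\<^sup>2)"
    using bridge_test_values[OF d3 pq] by metis
  define f where "f v = (if v \<in> S then if v = x then \<beta> else \<alpha> else if v = y then \<gamma> else \<delta>)" for v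
  have sum_f: "(\<Sum>v\<in>verts G. g (f v)) = real p * g \<alpha> + g \<beta> + g \<gamma> + real q * g \<delta>" for g :: "real \<Rightarrow> real"
  proof -
    have "(\<Sum>v\<in>verts G. g (f v)) = (\<Sum>v\<in>S. g (f v)) + (\<Sum>v\<in>?T. g (f v))"
      using sum.subset_diff[OF S finite_verts, of "\<lambda>v. g (f v)"] by simp
    also have "(\<Sum>v\<in>S. g (f v)) = g \<beta> + (\<Sum>v\<in>S - {x}. g \<alpha>)"
      using xy by (subst sum.remove[OF fin(1) xy(2)]) (auto simp: f_def)
    also have "(\<Sum>v\<in>?T. g (f v)) = g \<gamma> + (\<Sum>v\<in>?T - {y}. g \<delta>)"
      using xy by (subst sum.remove[OF fin(2) xy(3)]) (auto simp: f_def)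
    finally show ?thesis using fin xy by (simp add: p_def q_def)
  qed
  have deg: "(\<Sum>e\<in>edges G. if e \<noteq> e0 \<and> v \<in> ends G e then c else 0) = (real d - 1) * c"
    if "v \<in> ends G e0" for v and c :: real
  proof -
    have v: "v \<in> verts G" using that ends_subset[OF e0] by auto
    have "real d = (\<Sum>e\<in>edges G. if v \<in> ends G e then 1 else 0)"
      using reg v unfolding of_nat_card_filter[OF finite_edges, symmetric]
      by (simp add: regular_def vertex_degree_def)
    also have "\<dots> = (\<Sum>e\<in>edges G. (if e = e0 then 1 else 0) + (if e \<noteq> e0 \<and> v \<in> ends G e then 1 else 0))"
      using that by (intro sum.cong) auto
    also have "\<dots> = 1 + (\<Sum>e\<in>edges G. if e \<noteq> e0 \<and> v \<in> ends G e then 1 else 0)"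
      using e0 finite_edges by (simp add: sum.distrib)
    finally have "(\<Sum>e\<in>edges G. if e \<noteq> e0 \<and> v \<in> ends G e then 1 else 0) = real d - 1" by simp
    hence "(\<Sum>e\<in>edges G. (if e \<noteq> e0 \<and> v \<in> ends G e then 1 else 0) * c) = (real d - 1) * c"
      by (simp only: sum_distrib_right[symmetric])
    thus ?thesis by (simp add: if_distrib[of "\<lambda>z. z * c"] cong: if_cong)
  qed
  have "edge_energy G f e = (if e = e0 then (\<beta> - \<gamma>)\<^sup>2 else 0)
      + (if e \<noteq> e0 \<and> x \<in> ends G e then (\<alpha> - \<beta>)\<^sup>2 else 0)
      + (if e \<noteq> e0 \<and> y \<in> ends G e then (\<gamma> - \<delta>)\<^sup>2 else 0)" if e: "e \<in> edges G" for e
  proof -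
    obtain a b where ab: "ends G e = {a, b}" "a \<noteq> b" "a \<in> verts G" "b \<in> verts G"
      using e by (rule ends_doubleton)
    show ?thesis
    proof (cases "e = e0")
      case True
      have "edge_energy G f e0 = (f x - f y)\<^sup>2"
        using xy by (intro edge_energy_doubleton) auto
      thus ?thesis using True xy by (simp add: f_def)
    next
      case False
      hence "e \<notin> cut G S" using cut by simp
      hence "a \<in> S \<longleftrightarrow> b \<in> S" using e ab by (auto simp: cut_def)
      thus ?thesis
        unfolding edge_energy_doubleton[OF ab(1,2)] ab(1) using False ab(2) xy
        by (auto simp: f_def power2_commute)
    qed
  qed
  hence "(\<Sum>e\<in>edges G. edge_energy G f e)
    = (\<beta> - \<gamma>)\<^sup>2 + (real d - 1) * (\<alpha> - \<beta>)\<^sup>2 + (real d - 1) * (\<gamma> - \<delta>)\<^sup>2"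
    using e0 finite_edges xy by (simp add: sum.distrib deg)
  hence energy: "(\<Sum>e\<in>edges G. edge_energy G f e) \<le> (real d - \<rho> d n) * (\<Sum>v\<in>verts G. (f v)\<^sup>2)"
    using en sum_f[of "\<lambda>z. z\<^sup>2"] by simp
  have "\<exists>v\<in>verts G. f v \<noteq> 0"
  proof (rule ccontr)
    assume "\<not> ?thesis"
    hence zero: "f v = 0" if "v \<in> verts G" for v using that by blast
    have "card (S - {x}) \<ge> 2" "card (?T - {y}) \<ge> 2"
      using odd(3,5) xy fin by simp_all
    hence "S - {x} \<noteq> {}" "?T - {y} \<noteq> {}" by fastforce+
    then obtain v w where "v \<in> S" "v \<noteq> x" "w \<in> ?T" "w \<noteq> y" by auto
    thus False using zero[of x] zero[of v] zero[of y] zero[of w] xy S ne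
      by (auto simp: f_def)
  qed
  from second_eigenvalue_ge_energy[OF reg vs _ this energy]
  show ?thesis using sum_f[of "\<lambda>z. z"] sum0 by (simp add: n_def)
qed

text \<open>
  The set of vertices reachable from a fixed vertex after deleting \<open>F\<close>.
\<close>

lemma obtain_cut_of_disconnected:
  assumes "verts G \<noteq> {}" and "\<not> connected_mgraph (delete_edges G F)"
  obtains S where "S \<subseteq> verts G" "S \<noteq> {}" "S \<noteq> verts G" "cut G S \<subseteq> F"
proof -
  let ?R = "(adjacency (delete_edges G F))\<^sup>*"
  obtain u v where uv: "u \<in> verts G" "v \<in> verts G" "(u, v) \<notin> ?R"
    using assms by (auto simp: connected_mgraph_def delete_edges_def)
  let ?S = "{w \<in> verts G. (u, w) \<in> ?R}"
  have "cut G ?S \<subseteq> F"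
  proof
    fix e assume "e \<in> cut G ?S"
    hence e: "e \<in> edges G" "ends G e \<inter> ?S \<noteq> {}" "\<not> ends G e \<subseteq> ?S" by (auto simp: cut_def)
    show "e \<in> F"
    proof (rule ccontr)
      assume "e \<notin> F"
      obtain a b where ab: "ends G e = {a, b}" "a \<in> verts G" "b \<in> verts G"
        using e(1) by (metis ends_doubleton)
      have "(a, b) \<in> adjacency (delete_edges G F)" "(b, a) \<in> adjacency (delete_edges G F)"
        using e(1) \<open>e \<notin> F\<close> ab by (auto simp: adjacency_def delete_edges_def doubleton_eq_iff)
      hence "(u, a) \<in> ?R \<longleftrightarrow> (u, b) \<in> ?R" by (meson rtrancl.rtrancl_into_rtrancl)
      thus False using e(2,3) ab by auto
    qed
  qed
  thus thesis using that[of ?S] uv by auto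
qed

text \<open>
  The two ends of any edge form a component of a perfect matching.
\<close>

lemma one_regular_cut:
  assumes "regular G 1" and "card (verts G) \<ge> 3"
  obtains S where "S \<subseteq> verts G" "S \<noteq> {}" "S \<noteq> verts G" "cut G S = {}"
proof -
  obtain v where v: "v \<in> verts G" using assms(2) by fastforce
  hence "card {e \<in> edges G. v \<in> ends G e} = 1"
    using assms(1) by (simp add: regular_def vertex_degree_def)
  then obtain e where e: "e \<in> edges G" "v \<in> ends G e" by (metis (no_types, lifting) card_1_singletonE insertI1 mem_Collect_eq)
  have "cut G (ends G e) = {}"
  proof (rule ccontr)
    assume "cut G (ends G e) \<noteq> {}"
    then obtain e' w where e': "e' \<in> edges G" "w \<in> ends G e'" "w \<in> ends G e" "e' \<noteq> e"
      by (auto simp: cut_def)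
    have "card {e, e'} \<le> card {e \<in> edges G. w \<in> ends G e}"
      using e e' finite_edges by (intro card_mono) auto
    also have "\<dots> = 1"
      using assms(1) e' ends_subset[OF e(1)] by (auto simp: regular_def vertex_degree_def)
    finally show False using e'(4) by simp
  qed
  moreover have "ends G e \<noteq> verts G" using no_loops[OF e(1)] assms(2) by auto
  ultimately show thesis using that[of "ends G e"] ends_subset[OF e(1)] e(2) by auto
qed

text \<open>
  The maximum in the definition exists because deleting all edges disconnects two vertices.
\<close>

lemma edge_connectivity_ge:
  assumes "card (verts G) \<ge> 2" and "edge_connected k G"
  shows "edge_connectivity G \<ge> k"
proof -
  have "k' \<le> card (edges G)" if "edge_connected k' G" for k'
  proof (rule ccontr)
    assume "\<not> k' \<le> card (edges G)"
    hence conn: "connected_mgraph (delete_edges G (edges G))"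
      using that by (auto simp: edge_connected_def)
    have "adjacency (delete_edges G (edges G)) = {}"
      by (auto simp: adjacency_def delete_edges_def)
    hence "u = v" if "u \<in> verts G" "v \<in> verts G" for u v
      using conn that by (auto simp: connected_mgraph_def delete_edges_def)
    hence "card (verts G) \<le> 1"
      using finite_verts by (simp add: card_le_Suc0_iff_eq)
    thus False using assms(1) by simp
  qed
  thus ?thesis
    unfolding edge_connectivity_def using assms(2) by (blast intro: Greatest_le_nat)
qed

end

section \<open>Edge-connectivity from the second eigenvalue\<close>

theorem theorem1p14:
  fixes G :: "('v, 'e) mgraph" and vs :: "'v list" and n d :: nat
  assumes "multigraph G"
    and "card (verts G) = n"
    and "distinct vs" and "set vs = verts G"
    and "regular G d"
    and "n \<ge> 5" and "d \<ge> 1"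
    and "second_eigenvalue (adjacency_matrix G vs) < \<rho> d n"
  shows "edge_connectivity G \<ge> 2"
proof -
  interpret multigraph G by fact
  \<comment> \<open>An empty cut would give \<open>\<rho> d n \<le> d \<le> \<lambda>\<^sub>2\<close>.\<close>
  have no_empty_cut: "cut G S \<noteq> {}" if "S \<subseteq> verts G" "S \<noteq> {}" "S \<noteq> verts G" for S
    using second_eigenvalue_ge_degree[OF assms(5,3,4) that] rho_root(2)[OF assms(6,7)] assms(8)
    by fastforce
  have "d \<noteq> 1"
  proof
    assume "d = 1"
    hence "regular G 1" "card (verts G) \<ge> 3" using assms(2,5,6) by simp_all
    thus False using one_regular_cut no_empty_cut by metis
  qed
  have "edge_connected 2 G"
    unfolding edge_connected_def
  proof (intro allI impI)
    fix F assume F: "F \<subseteq> edges G" "card F < 2"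
    show "connected_mgraph (delete_edges G F)"
    proof (rule ccontr)
      assume disc: "\<not> connected_mgraph (delete_edges G F)"
      have "verts G \<noteq> {}" using assms(2,6) by auto
      from obtain_cut_of_disconnected[OF this disc] obtain S where
        S: "S \<subseteq> verts G" "S \<noteq> {}" "S \<noteq> verts G" "cut G S \<subseteq> F" .
      have "finite F" using F(1) finite_edges by (rule finite_subset)
      hence "card (cut G S) \<le> 1" using card_mono[OF _ S(4)] F(2) by linarith
      moreover have "finite (cut G S)" using S(4) \<open>finite F\<close> by (rule finite_subset)
      hence "card (cut G S) \<noteq> 0" using no_empty_cut[OF S(1-3)] by simp
      ultimately have "card (cut G S) = 1" by linarith
      then obtain e0 where "cut G S = {e0}" by (rule card_1_singletonE)
      from second_eigenvalue_ge_rho_of_bridge[OF assms(5,3,4,7) \<open>d \<noteq> 1\<close> S(1) this]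
      show False using assms(2,8) by simp
    qed
  qed
  thus ?thesis using edge_connectivity_ge[of 2] assms(2,6) by simp
qed

end
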